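(* (Lyapunov feedback stabilization of the controlled dispersive model.) Write $w(u)=\sqrt{1+\lambda^2u^2}$. There exists $\delta>0$ such that for $\tilde\rho\in S^1$ the expression $$-\frac{\sin(2\lambda w(1))}{\lambda w(1)}\,\bigl|\mathrm{Tr}[\tilde\rho(\sigma_++\sigma_-)]\bigr|+\frac{2\sin^2(\lambda w(1))}{w(1)^2}\,\mathrm{Tr}[\tilde\rho\sigma_z]$$ is strictly negative whenever $\mathrm{Tr}[\tilde\rho\sigma_z]<1-\delta$; in fact, $\delta$ is the solution of $$-\frac{\sin(2\lambda w(1))}{\lambda w(1)}\sqrt{(2-\delta)\delta}+\frac{2\sin^2(\lambda w(1))}{w(1)^2}(1-\delta)=0 .$$ With this $\delta$, define the feedback function $$g(\tilde\rho)=\begin{cases}0&\text{if }\mathrm{Tr}[\tilde\rho\sigma_z]\ge1-\delta,\\-1&\text{if }\mathrm{Tr}[\tilde\rho(\sigma_++\sigma_-)]<0\text{ and }\mathrm{Tr}[\tilde\rho\sigma_z]<1-\delta,\\+1&\text{if }\mathrm{Tr}[\tilde\rho(\sigma_++\sigma_-)]\ge0\text{ and }\mathrm{Tr}[\tilde\rho\sigma_z]<1-\delta.\end{cases}$$ Let $(\rho_l)_{l\ge0}$ be the controlled homodyne filter of the context with $u_l=g(\rho_{l-1})$ and initial condition $\rho_0\in S^1$ (so that $\rho_l\in S^1$ for all $l$). Then, with $V(\rho)=1-\mathrm{Tr}[\rho\sigma_z]$, one has $\mathbf{E}(V(\rho_l)-V(\rho_{l-1})\,|\,\sigma\{\rho_{l-1}\})\le0$,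 where equality holds only when $\mathrm{Tr}[\rho_{l-1}\sigma_z]\ge1-\delta$, and $$\liminf_{l\to\infty}\mathrm{Tr}[\rho_l\sigma_z]\ge1-\delta\quad\text{with unit probability.}$$ For $\lambda\ll1$ the threshold $\delta$ is very small; for example, $\delta\approx5.6\times10^{-6}$ when $\lambda^{-2}=300$.
   Context: $\lambda>0$ is the fixed time-step parameter of the model (each time slice has length $\lambda^2$). $\sigma_-=\begin{pmatrix}0&0\\1&0\end{pmatrix}$, $\sigma_+=\sigma_-^*$, $\sigma_z=\mathrm{diag}(1,-1)$. $S^1$ is the set of density matrices $\begin{pmatrix}\frac12+\frac12\cos\theta&\frac12\sin\theta\\\frac12\sin\theta&\frac12-\frac12\cos\theta\end{pmatrix}$, $\theta\in[0,2\pi)$. The controlled dispersive interaction model has coefficients $$M^+(u)=\frac{\sin(\lambda w(u))}{\lambda w(u)}\sigma_z,\qquad M^\circ(u)=\frac{\cos(\lambda w(u))-1}{\lambda^2}I+\frac{\sin(\lambda w(u))}{\lambda w(u)}\,u\,(\sigma_+-\sigma_-).$$ Put $\overline{\mathcal{L}}(\rho,u)=M^+(u)\rho M^+(u)^*+\lambda^2M^\circ(u)\rho M^\circ(u)^*+M^\circ(u)\rho+\rho M^\circ(u)^*$, $\overline{\mathcal{J}}(\rho,u)=M^+(u)\rho+\rho M^+(u)^*+\lambda^2M^+(u)\rho M^\circ(u)^*+\lambda^2M^\circ(u)\rho M^+(u)^*$. The controlled homodyne filter with separated feedback $u_l=g(\rho_{l-1})$ is the Markov chain of density matrices driven by observations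 $\Delta y_l\in\{\lambda,-\lambda\}$ with $$\mathbf{P}(\Delta y_l=\pm\lambda\,|\,\Delta y_1,\ldots,\Delta y_{l-1})=\tfrac12\pm\tfrac\lambda2\mathrm{Tr}[\overline{\mathcal{J}}(\rho_{l-1},u_l)],$$ $$\rho_l=\rho_{l-1}+\lambda^2\overline{\mathcal{L}}(\rho_{l-1},u_l)+\frac{\overline{\mathcal{J}}(\rho_{l-1},u_l)-\mathrm{Tr}[\overline{\mathcal{J}}(\rho_{l-1},u_l)]\,(\rho_{l-1}+\lambda^2\overline{\mathcal{L}}(\rho_{l-1},u_l))}{1-\lambda^2\mathrm{Tr}[\overline{\mathcal{J}}(\rho_{l-1},u_l)]^2}\bigl(\Delta y_l-\lambda^2\mathrm{Tr}[\overline{\mathcal{J}}(\rho_{l-1},u_l)]\bigr).$$ *)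

theory Defs
  imports "HOL-Probability.Probability"
begin

type_synonym cmat2 = "complex ^ 2 ^ 2"

definition mat2 :: "complex \<Rightarrow> complex \<Rightarrow> complex \<Rightarrow> complex \<Rightarrow> cmat2" where
  "mat2 a b c d = vector [vector [a, b], vector [c, d]]"

definition adj :: "cmat2 \<Rightarrow> cmat2" where
  "adj A = (\<chi> i j. cnj (A $ j $ i))"

(* Every trace in the model is a trace of a Hermitian matrix, or of a product of two
   Hermitian matrices, hence real. *)
definition rtr :: "cmat2 \<Rightarrow> real" where
  "rtr A = Re (trace A)"

definition sigma_minus :: cmat2 where
  "sigma_minus = mat2 0 0 1 0"

definition sigma_plus :: cmat2 where
  "sigma_plus = adj sigma_minus"

definition sigma_z :: cmat2 where
  "sigma_z = mat2 1 0 0 (- 1)"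

definition S1 :: "cmat2 set" where
  "S1 = {mat2 (of_real (1/2 + cos \<theta> / 2)) (of_real (sin \<theta> / 2))
              (of_real (sin \<theta> / 2)) (of_real (1/2 - cos \<theta> / 2)) | \<theta>::real. 0 \<le> \<theta> \<and> \<theta> < 2 * pi}"

definition w :: "real \<Rightarrow> real \<Rightarrow> real" where
  "w lam u = sqrt (1 + lam\<^sup>2 * u\<^sup>2)"

definition M_plus :: "real \<Rightarrow> real \<Rightarrow> cmat2" where
  "M_plus lam u = (sin (lam * w lam u) / (lam * w lam u)) *\<^sub>R sigma_z"

definition M_circ :: "real \<Rightarrow> real \<Rightarrow> cmat2" where
  "M_circ lam u = ((cos (lam * w lam u) - 1) / lam\<^sup>2) *\<^sub>R mat 1
     + (sin (lam * w lam u) / (lam * w lam u) * u) *\<^sub>R (sigma_plus - sigma_minus)"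

definition Lbar :: "real \<Rightarrow> cmat2 \<Rightarrow> real \<Rightarrow> cmat2" where
  "Lbar lam \<rho> u =
     M_plus lam u ** \<rho> ** adj (M_plus lam u)
     + lam\<^sup>2 *\<^sub>R (M_circ lam u ** \<rho> ** adj (M_circ lam u))
     + M_circ lam u ** \<rho> + \<rho> ** adj (M_circ lam u)"

definition Jbar :: "real \<Rightarrow> cmat2 \<Rightarrow> real \<Rightarrow> cmat2" where
  "Jbar lam \<rho> u =
     M_plus lam u ** \<rho> + \<rho> ** adj (M_plus lam u)
     + lam\<^sup>2 *\<^sub>R (M_plus lam u ** \<rho> ** adj (M_circ lam u))
     + lam\<^sup>2 *\<^sub>R (M_circ lam u ** \<rho> ** adj (M_plus lam u))"

(* The denominator vanishes exactly when one of the two outcomes has conditional probability 0.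
   The convention x / 0 = 0 then yields \<rho> + lam^2 L(\<rho>,u), which is the correct state after
   the outcome that occurs with conditional probability 1. *)
definition filter_step :: "real \<Rightarrow> cmat2 \<Rightarrow> real \<Rightarrow> real \<Rightarrow> cmat2" where
  "filter_step lam \<rho> u dy =
     \<rho> + lam\<^sup>2 *\<^sub>R Lbar lam \<rho> u
     + ((dy - lam\<^sup>2 * rtr (Jbar lam \<rho> u)) / (1 - lam\<^sup>2 * (rtr (Jbar lam \<rho> u))\<^sup>2)) *\<^sub>R
         (Jbar lam \<rho> u - rtr (Jbar lam \<rho> u) *\<^sub>R (\<rho> + lam\<^sup>2 *\<^sub>R Lbar lam \<rho> u))"

(* The sigma-algebra generated by the observations dy 1, ..., dy n
   (the trivial one for n = 0). *)
definition obs_algebra :: "'a measure \<Rightarrow> (nat \<Rightarrow> 'a \<Rightarrow> real) \<Rightarrow> nat \<Rightarrow> 'a measure" where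
  "obs_algebra M dy n =
     vimage_algebra (space M) (\<lambda>\<omega>. \<lambda>i\<in>{1..n}. dy i \<omega>) (Pi\<^sub>M {1..n} (\<lambda>_. borel))"

(* The value of dy at index 0 is irrelevant: the observations are dy 1, dy 2, ... *)
definition homodyne_filter ::
  "'a measure \<Rightarrow> real \<Rightarrow> (cmat2 \<Rightarrow> real) \<Rightarrow> cmat2 \<Rightarrow>
   (nat \<Rightarrow> 'a \<Rightarrow> real) \<Rightarrow> (nat \<Rightarrow> 'a \<Rightarrow> cmat2) \<Rightarrow> bool" where
  "homodyne_filter M lam g \<rho>0 dy \<rho> \<longleftrightarrow>
     prob_space M \<and>
     (\<forall>l\<ge>1. dy l \<in> borel_measurable M \<and> (\<forall>\<omega>\<in>space M. dy l \<omega> \<in> {lam, - lam})) \<and>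
     (\<forall>\<omega>\<in>space M. \<rho> 0 \<omega> = \<rho>0) \<and>
     (\<forall>l\<ge>1. \<forall>\<omega>\<in>space M.
        \<rho> l \<omega> = filter_step lam (\<rho> (l - 1) \<omega>) (g (\<rho> (l - 1) \<omega>)) (dy l \<omega>)) \<and>
     (\<forall>l\<ge>1.
        (AE \<omega> in M. real_cond_exp M (obs_algebra M dy (l - 1))
             (indicator {\<omega> \<in> space M. dy l \<omega> = lam}) \<omega>
           = 1/2 + lam / 2 * rtr (Jbar lam (\<rho> (l - 1) \<omega>) (g (\<rho> (l - 1) \<omega>)))) \<and>
        (AE \<omega> in M. real_cond_exp M (obs_algebra M dy (l - 1))
             (indicator {\<omega> \<in> space M. dy l \<omega> = - lam}) \<omega>
           = 1/2 - lam / 2 * rtr (Jbar lam (\<rho> (l - 1) \<omega>) (g (\<rho> (l - 1) \<omega>)))))"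

definition lyap_drift :: "real \<Rightarrow> cmat2 \<Rightarrow> real" where
  "lyap_drift lam \<rho> =
     - (sin (2 * lam * w lam 1) / (lam * w lam 1)) * \<bar>rtr (\<rho> ** (sigma_plus + sigma_minus))\<bar>
     + 2 * (sin (lam * w lam 1))\<^sup>2 / (w lam 1)\<^sup>2 * rtr (\<rho> ** sigma_z)"

definition threshold_eq :: "real \<Rightarrow> real \<Rightarrow> bool" where
  "threshold_eq lam \<delta> \<longleftrightarrow>
     - (sin (2 * lam * w lam 1) / (lam * w lam 1)) * sqrt ((2 - \<delta>) * \<delta>)
     + 2 * (sin (lam * w lam 1))\<^sup>2 / (w lam 1)\<^sup>2 * (1 - \<delta>) = 0"

definition feedback :: "real \<Rightarrow> cmat2 \<Rightarrow> real" where
  "feedback \<delta> \<rho> =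
     (if rtr (\<rho> ** sigma_z) \<ge> 1 - \<delta> then 0
      else if rtr (\<rho> ** (sigma_plus + sigma_minus)) < 0 then - 1
      else 1)"

definition V :: "cmat2 \<Rightarrow> real" where
  "V \<rho> = 1 - rtr (\<rho> ** sigma_z)"

end

(* A real pure state is a point of the circle x^2 + z^2 = 1, and each outcome acts on it by a real
   Kraus operator, so the filter never leaves the circle. Averaging over the outcome removes the
   innovation term, and where the control is u = sgn x the expected increment of V is lam^2 times the drift
   expression, which is a positive multiple of sin (theta0 - theta) in the angle theta of the
   state measured from the excited state. No martingale convergence theorem is needed for the
   limit: since V is bounded, the expected decrements of V are summable, so almost surely they
   tend to 0, and by compactness they are bounded away from 0 wherever z stays below
   1 - delta by a fixed amount. *)

theory Submission
  imports Defs
begin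

section \<open>Real matrices and the Bloch circle\<close>

text \<open>The equation for \<delta> is linear in the pair (1 - \<delta>, sqrt ((2 - \<delta>)
  \<delta>)), a point (z, y) of the half circle y >= 0, so it fixes only the direction z : y = w cos
  (\<lambda> w) : \<lambda> sin (\<lambda> w), where w = w(1). Scaling to length 1 gives
  \<open>threshold\<close>; the factor \<open>sgn s\<close> selects the representative with y > 0,
  because for large \<lambda> the sine can be negative. Two degenerate cases shape the proof. If sin
  (\<lambda> w) = 0, the equation holds for every \<delta> and determines nothing, so a value has to
  be chosen. If one outcome has probability 0, the update divides by 0 and returns the averaged
  state. An average of pure states is usually mixed, so staying on the circle needs its own argument
  in that case.\<close>

definition rmat2 :: "real \<Rightarrow> real \<Rightarrow> real \<Rightarrow> real \<Rightarrow> cmat2" where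
  "rmat2 a b c d = mat2 (of_real a) (of_real b) (of_real c) (of_real d)"

text \<open>Splits a matrix identity into four real ones, which \<open>field_simps\<close> can
  settle separately.\<close>

lemma rmat2_cong: "a = a' \<Longrightarrow> b = b' \<Longrightarrow> c = c' \<Longrightarrow> d = d' \<Longrightarrow> rmat2 a b c d = rmat2 a' b' c' d'"
  by simp

lemma rmat2_mult: "rmat2 a b c d ** rmat2 a' b' c' d' =
    rmat2 (a * a' + b * c') (a * b' + b * d') (c * a' + d * c') (c * b' + d * d')"
  by (simp add: rmat2_def mat2_def vec_eq_iff forall_2 matrix_matrix_mult_def sum_2)

lemma rmat2_add: "rmat2 a b c d + rmat2 a' b' c' d' = rmat2 (a + a') (b + b') (c + c') (d + d')"
  by (simp add: rmat2_def mat2_def vec_eq_iff forall_2)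

lemma rmat2_diff: "rmat2 a b c d - rmat2 a' b' c' d' = rmat2 (a - a') (b - b') (c - c') (d - d')"
  by (simp add: rmat2_def mat2_def vec_eq_iff forall_2)

lemma rmat2_scaleR: "r *\<^sub>R rmat2 a b c d = rmat2 (r * a) (r * b) (r * c) (r * d)"
  by (simp add: rmat2_def mat2_def vec_eq_iff forall_2 scaleR_complex.ctr complex_eq_iff)

lemma rmat2_one: "mat 1 = rmat2 1 0 0 1"
  by (simp add: rmat2_def mat2_def vec_eq_iff forall_2 mat_def)

lemma adj_rmat2: "adj (rmat2 a b c d) = rmat2 a c b d"
  by (simp add: rmat2_def mat2_def vec_eq_iff forall_2 adj_def)

lemma rtr_rmat2: "rtr (rmat2 a b c d) = a + d"
  by (simp add: rmat2_def mat2_def rtr_def trace_def sum_2)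

lemma sigma_minus_rmat2: "sigma_minus = rmat2 0 0 1 0"
  by (simp add: sigma_minus_def rmat2_def)

lemma sigma_plus_rmat2: "sigma_plus = rmat2 0 1 0 0"
  by (simp add: sigma_plus_def sigma_minus_rmat2 adj_rmat2)

lemma sigma_z_rmat2: "sigma_z = rmat2 1 0 0 (- 1)"
  by (simp add: sigma_z_def rmat2_def)

lemmas rmat2_simps = rmat2_mult rmat2_add rmat2_diff rmat2_scaleR rmat2_one adj_rmat2 rtr_rmat2
  sigma_minus_rmat2 sigma_plus_rmat2 sigma_z_rmat2

text \<open>The matrix \<open>(t I + x \<sigma>\<^sub>x + z \<sigma>\<^sub>z) / 2\<close>.\<close>

definition bloch :: "real \<Rightarrow> real \<Rightarrow> real \<Rightarrow> cmat2" where
  "bloch t x z = rmat2 ((t + z) / 2) (x / 2) (x / 2) ((t - z) / 2)"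

lemma rtr_bloch: "rtr (bloch t x z) = t"
  by (simp add: bloch_def rmat2_simps field_simps)

lemma rtr_bloch_sigma_z: "rtr (bloch t x z ** sigma_z) = z"
  by (simp add: bloch_def rmat2_simps field_simps)

lemma rtr_bloch_sigma_x: "rtr (bloch t x z ** (sigma_plus + sigma_minus)) = x"
  by (simp add: bloch_def rmat2_simps field_simps)

lemma bloch_add: "bloch t x z + bloch t' x' z' = bloch (t + t') (x + x') (z + z')"
  unfolding bloch_def rmat2_simps by (rule rmat2_cong) (simp_all add: field_simps)

lemma bloch_diff: "bloch t x z - bloch t' x' z' = bloch (t - t') (x - x') (z - z')"
  unfolding bloch_def rmat2_simps by (rule rmat2_cong) (simp_all add: field_simps)

lemma bloch_scaleR: "r *\<^sub>R bloch t x z = bloch (r * t) (r * x) (r * z)"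
  unfolding bloch_def rmat2_simps by (rule rmat2_cong) (simp_all add: field_simps)

text \<open>In Cartesian coordinates the purity and mean-value identities become polynomial in x and
  z and come within reach of \<open>algebra\<close>.\<close>

lemma S1_eq_bloch: "S1 = {bloch 1 x z | x z. x\<^sup>2 + z\<^sup>2 = 1}"
proof -
  have "mat2 (of_real (1/2 + cos \<theta> / 2)) (of_real (sin \<theta> / 2))
      (of_real (sin \<theta> / 2)) (of_real (1/2 - cos \<theta> / 2)) = bloch 1 (sin \<theta>) (cos \<theta>)" for \<theta>
    by (simp add: bloch_def rmat2_def add_divide_distrib diff_divide_distrib)
  then have "S1 = {bloch 1 (sin \<theta>) (cos \<theta>) | \<theta>. 0 \<le> \<theta> \<and> \<theta> < 2 * pi}"
    unfolding S1_def by simp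
  also have "\<dots> = {bloch 1 x z | x z. x\<^sup>2 + z\<^sup>2 = 1}"
  proof (intro equalityI subsetI)
    fix \<rho> assume "\<rho> \<in> {bloch 1 (sin \<theta>) (cos \<theta>) | \<theta>. 0 \<le> \<theta> \<and> \<theta> < 2 * pi}"
    then obtain \<theta> where "\<rho> = bloch 1 (sin \<theta>) (cos \<theta>)" by blast
    then show "\<rho> \<in> {bloch 1 x z | x z. x\<^sup>2 + z\<^sup>2 = 1}" using sin_cos_squared_add[of \<theta>] by blast
  next
    fix \<rho> assume "\<rho> \<in> {bloch 1 x z | x z. x\<^sup>2 + z\<^sup>2 = 1}"
    then obtain x z where \<rho>: "\<rho> = bloch 1 x z" "z\<^sup>2 + x\<^sup>2 = 1" by (auto simp: add.commute)
    obtain \<theta> where "0 \<le> \<theta>" "\<theta> < 2 * pi" "z = cos \<theta>" "x = sin \<theta>"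
      using sincos_total_2pi[OF \<rho>(2)] .
    with \<rho> show "\<rho> \<in> {bloch 1 (sin \<theta>) (cos \<theta>) | \<theta>. 0 \<le> \<theta> \<and> \<theta> < 2 * pi}" by auto
  qed
  finally show ?thesis .
qed

lemma S1_cases:
  assumes "\<rho> \<in> S1"
  obtains x z where "\<rho> = bloch 1 x z" "x\<^sup>2 + z\<^sup>2 = 1"
  using assms by (auto simp: S1_eq_bloch)

lemma bloch_in_S1: "x\<^sup>2 + z\<^sup>2 = 1 \<Longrightarrow> bloch 1 x z \<in> S1"
  by (auto simp: S1_eq_bloch)

lemma S1_z_bounds:
  assumes "\<rho> \<in> S1"
  shows "- 1 \<le> rtr (\<rho> ** sigma_z)" "rtr (\<rho> ** sigma_z) \<le> 1"
proof -
  obtain x z where \<rho>: "\<rho> = bloch 1 x z" "x\<^sup>2 + z\<^sup>2 = 1" using assms by (rule S1_cases)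
  then have "z\<^sup>2 \<le> 1\<^sup>2" using zero_le_power2[of x] unfolding one_power2 by linarith
  then have "\<bar>z\<bar> \<le> 1" by (simp only: power2_le_iff_abs_le)
  then show "- 1 \<le> rtr (\<rho> ** sigma_z)" "rtr (\<rho> ** sigma_z) \<le> 1"
    by (auto simp: \<rho> rtr_bloch_sigma_z)
qed

section \<open>The filter step\<close>

text \<open>\<open>s\<close>, \<open>c\<close>, \<open>b\<close> are the Pauli coefficients of the Kraus operators
  \<open>(c I + b (\<sigma>\<^sub>+ - \<sigma>\<^sub>-) \<plusminus> s \<sigma>\<^sub>z) / \<surd>2\<close> of the two outcomes.\<close>

definition kr_s :: "real \<Rightarrow> real \<Rightarrow> real" where "kr_s lam u = sin (lam * w lam u) / w lam u"
definition kr_c :: "real \<Rightarrow> real \<Rightarrow> real" where "kr_c lam u = cos (lam * w lam u)"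
definition kr_b :: "real \<Rightarrow> real \<Rightarrow> real" where "kr_b lam u = lam * u * kr_s lam u"

lemma w_pos: "w lam u > 0"
  unfolding w_def by (simp add: add_pos_nonneg)

lemma w_sq: "(w lam u)\<^sup>2 = 1 + lam\<^sup>2 * u\<^sup>2"
  unfolding w_def by simp

text \<open>This is trace preservation: the two Kraus operators K satisfy sum K^T K = I. It rests on
  b^2 + s^2 = s^2 w^2, which is what the square root in \<open>w\<close> provides.\<close>

lemma kr_normalized: "(kr_c lam u)\<^sup>2 + (kr_b lam u)\<^sup>2 + (kr_s lam u)\<^sup>2 = 1"
proof -
  have "(kr_b lam u)\<^sup>2 + (kr_s lam u)\<^sup>2 = (kr_s lam u)\<^sup>2 * (w lam u)\<^sup>2"
    unfolding kr_b_def w_sq by (simp add: algebra_simps power_mult_distrib)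
  also have "\<dots> = (sin (lam * w lam u))\<^sup>2"
    using w_pos[of lam u] by (simp add: kr_s_def power_divide)
  finally show ?thesis
    using sin_cos_squared_add2[of "lam * w lam u"] unfolding kr_c_def by linarith
qed

lemma M_plus_rmat2: "lam \<noteq> 0 \<Longrightarrow> M_plus lam u = rmat2 (kr_s lam u / lam) 0 0 (- (kr_s lam u / lam))"
  by (simp add: M_plus_def rmat2_simps kr_s_def mult.commute)

lemma M_circ_rmat2:
  assumes "lam \<noteq> 0"
  shows "M_circ lam u = rmat2 ((kr_c lam u - 1) / lam\<^sup>2) (kr_b lam u / lam\<^sup>2)
                            (- (kr_b lam u / lam\<^sup>2)) ((kr_c lam u - 1) / lam\<^sup>2)"
proof -
  have "sin (lam * w lam u) / (lam * w lam u) * u = kr_b lam u / lam\<^sup>2"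
    using assms by (simp add: kr_b_def kr_s_def power2_eq_square field_simps)
  then show ?thesis by (simp only: M_circ_def) (simp add: rmat2_simps kr_c_def)
qed

text \<open>The left side is A \<rho> A^T + B \<rho> B^T with A = I + \<lambda>^2
  \<open>M_circ\<close> and B = \<lambda> \<open>M_plus\<close>, the sum of the two unnormalised
  outcomes. Up to scaling, A rotates the Bloch vector and B reflects it in the z axis.\<close>

lemma Lbar_bloch:
  fixes lam u :: real
  assumes "lam \<noteq> 0"
  defines "s \<equiv> kr_s lam u" and "c \<equiv> kr_c lam u" and "b \<equiv> kr_b lam u"
  shows "bloch t x z + lam\<^sup>2 *\<^sub>R Lbar lam (bloch t x z) u =
    bloch t ((c\<^sup>2 - b\<^sup>2 - s\<^sup>2) * x - 2 * c * b * z) ((c\<^sup>2 - b\<^sup>2 + s\<^sup>2) * z + 2 * c * b * x)"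
proof -
  have n: "s\<^sup>2 = 1 - c\<^sup>2 - b\<^sup>2" using kr_normalized[of lam u] by (simp add: assms)
  have "bloch t x z + lam\<^sup>2 *\<^sub>R Lbar lam (bloch t x z) u =
     bloch ((c\<^sup>2 + b\<^sup>2 + s\<^sup>2) * t) ((c\<^sup>2 - b\<^sup>2 - s\<^sup>2) * x - 2 * c * b * z) ((c\<^sup>2 - b\<^sup>2 + s\<^sup>2) * z + 2 * c * b * x)"
    unfolding Lbar_def M_plus_rmat2[OF assms(1)] M_circ_rmat2[OF assms(1)]
      s_def[symmetric] c_def[symmetric] b_def[symmetric] bloch_def rmat2_simps
    using assms(1) by (intro rmat2_cong) (simp_all add: field_simps power2_eq_square)
  then show ?thesis using n by simp
qed

text \<open>With A and B as in \<open>Lbar_bloch\<close> this is B \<rho> A^T + A \<rho> B^T, the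
  difference of the two unnormalised outcomes.\<close>

lemma Jbar_bloch:
  fixes lam u :: real
  assumes "lam \<noteq> 0"
  defines "s \<equiv> kr_s lam u" and "c \<equiv> kr_c lam u" and "b \<equiv> kr_b lam u"
  shows "lam *\<^sub>R Jbar lam (bloch t x z) u =
    bloch (2 * s * (c * z + b * x)) (- 2 * b * s * t) (2 * c * s * t)"
    unfolding Jbar_def M_plus_rmat2[OF assms(1)] M_circ_rmat2[OF assms(1)]
      s_def[symmetric] c_def[symmetric] b_def[symmetric] bloch_def rmat2_simps
    using assms(1) by (intro rmat2_cong) (simp_all add: field_simps power2_eq_square)

lemma rtr_scaleR: "rtr (r *\<^sub>R A) = r * rtr A"
  by (simp add: rtr_def trace_def sum_2 algebra_simps)

text \<open>In units of \<lambda> the observation is 1 or -1, and \<tau> is the difference of the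
  two outcome probabilities (1 + \<tau>) / 2 and (1 - \<tau>) / 2. The formula covers \<tau>^2 = 1
  too: the quotient is then 0 on both sides.\<close>

lemma filter_step_bloch:
  fixes lam u x z dy :: real
  assumes "lam \<noteq> 0"
  defines "s \<equiv> kr_s lam u" and "c \<equiv> kr_c lam u" and "b \<equiv> kr_b lam u"
  defines "\<tau> \<equiv> 2 * s * (c * z + b * x)"
  defines "x' \<equiv> (c\<^sup>2 - b\<^sup>2 - s\<^sup>2) * x - 2 * c * b * z"
  defines "z' \<equiv> (c\<^sup>2 - b\<^sup>2 + s\<^sup>2) * z + 2 * c * b * x"
  defines "k \<equiv> (dy / lam - \<tau>) / (1 - \<tau>\<^sup>2)"
  shows "filter_step lam (bloch 1 x z) u dy =
           bloch 1 (x' + k * (- 2 * b * s - \<tau> * x')) (z' + k * (2 * c * s - \<tau> * z'))"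
    and "lam * rtr (Jbar lam (bloch 1 x z) u) = \<tau>"
proof -
  define J where "J = Jbar lam (bloch 1 x z) u"
  have lJ: "lam *\<^sub>R J = bloch \<tau> (- 2 * b * s) (2 * c * s)"
    unfolding J_def by (simp add: Jbar_bloch assms)
  have J: "J = (1 / lam) *\<^sub>R bloch \<tau> (- 2 * b * s) (2 * c * s)"
    using assms(1) unfolding lJ[symmetric] by simp
  have T: "rtr J = \<tau> / lam"
    unfolding J by (simp add: rtr_scaleR rtr_bloch)
  then show "lam * rtr (Jbar lam (bloch 1 x z) u) = \<tau>"
    using assms(1) by (simp add: J_def)
  have X: "bloch 1 x z + lam\<^sup>2 *\<^sub>R Lbar lam (bloch 1 x z) u = bloch 1 x' z'"
    using assms by (simp add: Lbar_bloch)
  have k: "(dy - lam\<^sup>2 * rtr J) / (1 - lam\<^sup>2 * (rtr J)\<^sup>2) = lam * k"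
  proof -
    have "lam\<^sup>2 * (rtr J)\<^sup>2 = \<tau>\<^sup>2" "dy - lam\<^sup>2 * rtr J = lam * (dy / lam - \<tau>)"
      using assms(1) by (simp_all add: T power_divide power2_eq_square field_simps)
    then show ?thesis by (simp add: k_def)
  qed
  show "filter_step lam (bloch 1 x z) u dy =
           bloch 1 (x' + k * (- 2 * b * s - \<tau> * x')) (z' + k * (2 * c * s - \<tau> * z'))"
    unfolding filter_step_def J_def[symmetric] X k
    unfolding T unfolding J bloch_scaleR bloch_diff bloch_add unfolding bloch_def
    using assms(1) by (intro rmat2_cong) (simp_all add: field_simps)
qed

text \<open>Twice the unnormalised outcome K \<rho> K^T has the Bloch vector on the left and the
  trace 1 + e \<tau>. As \<rho> has rank one, K \<rho> K^T has determinant 0, which says that its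
  Bloch vector is as long as its trace.\<close>

lemma outcome_pure:
  fixes x z s c b e :: real
  assumes "x\<^sup>2 + z\<^sup>2 = 1" "c\<^sup>2 + b\<^sup>2 + s\<^sup>2 = 1" "e\<^sup>2 = 1"
  shows "((c\<^sup>2 - b\<^sup>2 - s\<^sup>2) * x - 2 * c * b * z + e * (- 2 * b * s))\<^sup>2
       + ((c\<^sup>2 - b\<^sup>2 + s\<^sup>2) * z + 2 * c * b * x + e * (2 * c * s))\<^sup>2
       = (1 + e * (2 * s * (c * z + b * x)))\<^sup>2"
  using assms by algebra

lemma filter_step_S1:
  assumes lam: "lam \<noteq> 0" and \<rho>: "\<rho> \<in> S1" and dy: "dy \<in> {lam, - lam}"
  shows "filter_step lam \<rho> u dy \<in> S1"
proof -
  obtain x z where \<rho>_eq: "\<rho> = bloch 1 x z" and xz: "x\<^sup>2 + z\<^sup>2 = 1" using \<rho> by (rule S1_cases)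
  define s c b where "s = kr_s lam u" and "c = kr_c lam u" and "b = kr_b lam u"
  have n: "c\<^sup>2 + b\<^sup>2 + s\<^sup>2 = 1" using kr_normalized by (simp add: s_def c_def b_def)
  define \<tau> x' z' where "\<tau> = 2 * s * (c * z + b * x)"
    and "x' = (c\<^sup>2 - b\<^sup>2 - s\<^sup>2) * x - 2 * c * b * z"
    and "z' = (c\<^sup>2 - b\<^sup>2 + s\<^sup>2) * z + 2 * c * b * x"
  define p q where "p = - 2 * b * s" and "q = 2 * c * s"
  define e where "e = dy / lam"
  have e: "e\<^sup>2 = 1" using dy lam by (auto simp: e_def)
  define k where "k = (e - \<tau>) / (1 - \<tau>\<^sup>2)"
  have step: "filter_step lam \<rho> u dy = bloch 1 (x' + k * (p - \<tau> * x')) (z' + k * (q - \<tau> * z'))"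
    unfolding \<rho>_eq using filter_step_bloch(1)[OF lam, of x z u dy]
    by (simp add: k_def e_def p_def q_def \<tau>_def x'_def z'_def s_def c_def b_def)
  have pure: "(x' + f * p)\<^sup>2 + (z' + f * q)\<^sup>2 = (1 + f * \<tau>)\<^sup>2" if "f\<^sup>2 = 1" for f
    using outcome_pure[OF xz n that] by (simp add: p_def q_def \<tau>_def x'_def z'_def)
  have "(x' + k * (p - \<tau> * x'))\<^sup>2 + (z' + k * (q - \<tau> * z'))\<^sup>2 = 1"
  proof (cases "\<tau>\<^sup>2 = 1")
    \<comment> \<open>The update is ordinary conditioning here: the mean (x', z') plus e (p, q),
      divided by 1 + e \<tau>.\<close>
    case False
    have f: "1 - \<tau>\<^sup>2 = (1 - e * \<tau>) * (1 + e * \<tau>)"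
      using e by algebra
    then have ne: "1 - e * \<tau> \<noteq> 0" "1 + e * \<tau> \<noteq> 0" using False by auto
    have "e - \<tau> = e * (1 - e * \<tau>)" using e by algebra
    then have k: "k = e / (1 + e * \<tau>)" using ne by (simp add: k_def f)
    have x: "x' + k * (p - \<tau> * x') = (x' + e * p) / (1 + e * \<tau>)"
      and z: "z' + k * (q - \<tau> * z') = (z' + e * q) / (1 + e * \<tau>)"
      using ne(2) unfolding k by (simp_all add: field_simps)
    show ?thesis unfolding x z power_divide add_divide_distrib[symmetric] pure[OF e] using ne by simp
  next
    \<comment> \<open>The step returns the mean (x', z'). Now 1 = \<tau>^2 <= 4 s^2 (c^2 + b^2) =
      p^2 + q^2 = 1 - (1 - 2 s^2)^2 <= 1 by Cauchy-Schwarz, so p^2 + q^2 = 1. Adding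
      \<open>pure\<close> for f = 1 and f = -1 gives x'^2 + z'^2 + p^2 + q^2 = 1 + \<tau>^2 =
      2.\<close>
    case True
    then have k: "k = 0" by (simp add: k_def)
    have "(c * z + b * x)\<^sup>2 + (c * x - b * z)\<^sup>2 = c\<^sup>2 + b\<^sup>2" using xz by algebra
    then have "(c * z + b * x)\<^sup>2 \<le> c\<^sup>2 + b\<^sup>2" by (metis le_add_same_cancel1 zero_le_power2)
    then have "4 * s\<^sup>2 * (c * z + b * x)\<^sup>2 \<le> 4 * s\<^sup>2 * (c\<^sup>2 + b\<^sup>2)"
      by (intro mult_left_mono) auto
    moreover have "4 * s\<^sup>2 * (c * z + b * x)\<^sup>2 = 1" 
      using True by (simp add: \<tau>_def power_mult_distrib)
    moreover have "4 * s\<^sup>2 * (c\<^sup>2 + b\<^sup>2) = 1 - (1 - 2 * s\<^sup>2)\<^sup>2" using n by algebra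
    moreover have "p\<^sup>2 + q\<^sup>2 = 4 * s\<^sup>2 * (c\<^sup>2 + b\<^sup>2)" unfolding p_def q_def by algebra
    ultimately have "p\<^sup>2 + q\<^sup>2 = 1" using zero_le_power2[of "1 - 2 * s\<^sup>2"] by linarith
    then have "x'\<^sup>2 + z'\<^sup>2 = 1" using pure[of 1] pure[of "-1"] True
      by (simp add: power2_eq_square algebra_simps)
    then show ?thesis by (simp add: k)
  qed
  then show ?thesis unfolding step by (rule bloch_in_S1)
qed

text \<open>The value 0 above the threshold reflects the control u = 0: then b = 0 and the averaged
  z is unchanged.\<close>

definition vdrift :: "real \<Rightarrow> real \<Rightarrow> cmat2 \<Rightarrow> real" where
  "vdrift lam \<delta> \<rho> = (if rtr (\<rho> ** sigma_z) \<ge> 1 - \<delta> then 0 else lam\<^sup>2 * lyap_drift lam \<rho>)"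

lemma mean_V_filter_step:
  fixes lam \<delta> :: real
  assumes lam: "lam \<noteq> 0" and \<rho>: "\<rho> \<in> S1"
  defines "T \<equiv> rtr (Jbar lam \<rho> (feedback \<delta> \<rho>))"
  shows "(1/2 + lam / 2 * T) * V (filter_step lam \<rho> (feedback \<delta> \<rho>) lam)
       + (1/2 - lam / 2 * T) * V (filter_step lam \<rho> (feedback \<delta> \<rho>) (- lam)) = V \<rho> + vdrift lam \<delta> \<rho>"
proof -
  obtain x z where \<rho>_eq: "\<rho> = bloch 1 x z" and xz: "x\<^sup>2 + z\<^sup>2 = 1" using \<rho> by (rule S1_cases)
  define u where "u = feedback \<delta> \<rho>"
  define s c b where "s = kr_s lam u" and "c = kr_c lam u" and "b = kr_b lam u"
  have n: "c\<^sup>2 + b\<^sup>2 + s\<^sup>2 = 1" using kr_normalized by (simp add: s_def c_def b_def)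
  define \<tau> z' where "\<tau> = 2 * s * (c * z + b * x)"
    and "z' = (c\<^sup>2 - b\<^sup>2 + s\<^sup>2) * z + 2 * c * b * x"
  define q where "q = 2 * c * s"
  have V_step: "V (filter_step lam \<rho> u dy) = 1 - (z' + (dy / lam - \<tau>) / (1 - \<tau>\<^sup>2) * (q - \<tau> * z'))" for dy
    unfolding \<rho>_eq filter_step_bloch(1)[OF lam, of x z u dy] V_def rtr_bloch_sigma_z
    by (simp add: q_def \<tau>_def z'_def s_def c_def b_def)
  have T: "lam * T = \<tau>"
    unfolding T_def u_def[symmetric] unfolding \<rho>_eq filter_step_bloch(2)[OF lam]
    by (simp add: \<tau>_def s_def c_def b_def)
  have mean: "(1/2 + lam / 2 * T) * V (filter_step lam \<rho> u lam)
       + (1/2 - lam / 2 * T) * V (filter_step lam \<rho> u (- lam)) = 1 - z'"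
  proof -
    have "(1/2 + lam / 2 * T) * V (filter_step lam \<rho> u lam)
       + (1/2 - lam / 2 * T) * V (filter_step lam \<rho> u (- lam))
      = (1 + \<tau>) / 2 * (1 - (z' + (1 - \<tau>) / (1 - \<tau>\<^sup>2) * (q - \<tau> * z')))
       + (1 - \<tau>) / 2 * (1 - (z' + (- 1 - \<tau>) / (1 - \<tau>\<^sup>2) * (q - \<tau> * z')))"
      unfolding V_step using lam by (simp add: T[symmetric] add_divide_distrib diff_divide_distrib)
    also have "\<dots> = 1 - z'"
    proof -
      have "1 - \<tau>\<^sup>2 = (1 + \<tau>) * (1 - \<tau>)" by (simp add: power2_eq_square algebra_simps)
      \<comment> \<open>The innovation has mean 0. If \<tau>^2 = 1 both quotients are 0, so the
        identity survives division by 0.\<close>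
      then have k: "(1 + \<tau>) / 2 * ((1 - \<tau>) / (1 - \<tau>\<^sup>2)) + (1 - \<tau>) / 2 * ((- 1 - \<tau>) / (1 - \<tau>\<^sup>2)) = 0"
        by (cases "1 - \<tau>\<^sup>2 = 0") (auto simp: field_simps)
      have mix: "(1 + \<tau>) / 2 * (1 - (z' + k1 * m)) + (1 - \<tau>) / 2 * (1 - (z' + k2 * m))
          = 1 - z' - ((1 + \<tau>) / 2 * k1 + (1 - \<tau>) / 2 * k2) * m" for k1 k2 m :: real
        by (simp add: field_simps)
      show ?thesis unfolding mix k by simp
    qed
    finally show ?thesis .
  qed
  have "1 - z' = V \<rho> + vdrift lam \<delta> \<rho>"
  proof (cases "z \<ge> 1 - \<delta>")
    case True
    then have "u = 0" by (simp add: u_def feedback_def \<rho>_eq rtr_bloch_sigma_z)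
    then have b: "b = 0" by (simp add: b_def kr_b_def)
    then have "z' = z" using n unfolding z'_def by simp
    then show ?thesis using True by (simp add: vdrift_def V_def \<rho>_eq rtr_bloch_sigma_z)
  next
    case False
    have u: "u = (if x < 0 then - 1 else 1)"
      using False by (simp add: u_def feedback_def \<rho>_eq rtr_bloch_sigma_z rtr_bloch_sigma_x)
    have w: "w lam u = w lam 1" by (simp add: u w_def)
    \<comment> \<open>\<open>w\<close> and s are even in u while b is odd, so the sign of the
      feedback turns b x into a multiple of |x|.\<close>
    have bx: "b * x = lam * s * \<bar>x\<bar>" and b2: "b\<^sup>2 = lam\<^sup>2 * s\<^sup>2"
      using u by (auto simp: b_def kr_b_def s_def power_mult_distrib)
    have "sin (2 * lam * w lam 1) / (lam * w lam 1) = 2 * s * c / lam"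
      using sin_double[of "lam * w lam 1"] by (simp add: s_def c_def kr_s_def kr_c_def w mult.assoc)
    moreover have "2 * (sin (lam * w lam 1))\<^sup>2 / (w lam 1)\<^sup>2 = 2 * s\<^sup>2"
      by (simp add: s_def kr_s_def w power_divide)
    ultimately have ld: "lyap_drift lam \<rho> = - (2 * s * c / lam) * \<bar>x\<bar> + 2 * s\<^sup>2 * z"
      by (simp only: lyap_drift_def \<rho>_eq rtr_bloch_sigma_z rtr_bloch_sigma_x)
    have "lam\<^sup>2 * lyap_drift lam \<rho> = - 2 * c * (b * x) + 2 * b\<^sup>2 * z"
      using lam unfolding bx b2 ld by (simp add: power2_eq_square field_simps)
    moreover have "z' = z - 2 * b\<^sup>2 * z + 2 * c * (b * x)"
      using n unfolding z'_def by algebra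
    ultimately show ?thesis using False by (simp add: vdrift_def V_def \<rho>_eq rtr_bloch_sigma_z)
  qed
  then show ?thesis using mean by (simp add: u_def)
qed

section \<open>The threshold\<close>

text \<open>If \<open>sin (\<lambda> w(1)) = 0\<close> the drift vanishes identically; the value \<open>2\<close> then switches the
  control off on all of \<open>S\<^sup>1\<close>.\<close>

definition threshold :: "real \<Rightarrow> real" where
  "threshold lam =
     (let s = sin (lam * w lam 1); c = cos (lam * w lam 1) in
      if s = 0 then 2 else 1 - sgn s * c * w lam 1 / sqrt ((c * w lam 1)\<^sup>2 + (lam * s)\<^sup>2))"

text \<open>In the angle \<open>\<theta>\<close> with \<open>z = cos \<theta>\<close>, \<open>y = \<bar>sin \<theta>\<bar>\<close>, the Lyapunov drift is a
  multiple of \<open>sin (\<theta>\<^sub>0 - \<theta>)\<close>, where \<open>1 - \<delta> = cos \<theta>\<^sub>0\<close>.\<close>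

lemma drift_factorization:
  assumes lam: "lam > 0" and s: "sin (lam * w lam 1) \<noteq> 0"
  obtains K y0 where "K > 0" "y0 > 0" "(1 - threshold lam)\<^sup>2 + y0\<^sup>2 = 1"
    "\<And>y z. - (sin (2 * lam * w lam 1) / (lam * w lam 1)) * y
        + 2 * (sin (lam * w lam 1))\<^sup>2 / (w lam 1)\<^sup>2 * z
      = K * (y0 * z - (1 - threshold lam) * y)"
proof -
  define W S C where "W = w lam 1" and "S = sin (lam * W)" and "C = cos (lam * W)"
  have W: "W > 0" by (simp add: W_def w_pos)
  have S: "S \<noteq> 0" using s by (simp add: S_def W_def)
  \<comment> \<open>The coefficients 2 S C / (\<lambda> W) and 2 S^2 / W^2 of the drift are 2 |S| /
    (\<lambda> W^2) times sgn S C W and \<lambda> |S|. D is the length of this last pair.\<close>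
  define D where "D = sqrt ((C * W)\<^sup>2 + (lam * S)\<^sup>2)"
  have "(C * W)\<^sup>2 + (lam * S)\<^sup>2 > 0" using lam S by (intro add_nonneg_pos) auto
  then have D: "D > 0" and D2: "D\<^sup>2 = (C * W)\<^sup>2 + (lam * S)\<^sup>2" by (auto simp: D_def)
  have th: "1 - threshold lam = sgn S * C * W / D"
    using S by (simp add: threshold_def Let_def D_def S_def C_def W_def)
  define K y0 where "K = 2 * \<bar>S\<bar> * D / (lam * W\<^sup>2)" and "y0 = lam * \<bar>S\<bar> / D"
  have sg: "(sgn S)\<^sup>2 = 1" "\<bar>S\<bar> * sgn S = S" using S by (auto simp: sgn_if)
  show thesis
  proof
    show "K > 0" "y0 > 0" using W S D lam by (auto simp: K_def y0_def)
    show "(1 - threshold lam)\<^sup>2 + y0\<^sup>2 = 1"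
    proof -
      have "(sgn S * C * W)\<^sup>2 + (lam * \<bar>S\<bar>)\<^sup>2 = D\<^sup>2" by (simp add: D2 power_mult_distrib sg)
      then show ?thesis using D by (simp add: th y0_def power_divide flip: add_divide_distrib)
    qed
    show "- (sin (2 * lam * w lam 1) / (lam * w lam 1)) * y
        + 2 * (sin (lam * w lam 1))\<^sup>2 / (w lam 1)\<^sup>2 * z
      = K * (y0 * z - (1 - threshold lam) * y)" for y z
    proof -
      have "sin (2 * lam * w lam 1) = 2 * S * C"
        using sin_double[of "lam * W"] by (simp add: S_def C_def W_def mult.assoc)
      then have A: "sin (2 * lam * w lam 1) / (lam * w lam 1) = K * (1 - threshold lam)"
        unfolding W_def[symmetric] th K_def using W D lam sg(2)
        by (simp add: power2_eq_square field_simps)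
      have B: "2 * (sin (lam * w lam 1))\<^sup>2 / (w lam 1)\<^sup>2 = K * y0"
        unfolding W_def[symmetric] S_def[symmetric] K_def y0_def using W D lam
        by (simp add: power2_eq_square field_simps)
      show ?thesis unfolding A B by (simp add: algebra_simps)
    qed
  qed
qed

lemma threshold_pos:
  assumes "lam > 0" shows "threshold lam > 0"
proof (cases "sin (lam * w lam 1) = 0")
  case True then show ?thesis by (simp add: threshold_def)
next
  case False
  obtain K y0 where "y0 > 0" "(1 - threshold lam)\<^sup>2 + y0\<^sup>2 = 1"
    by (rule drift_factorization[OF assms False]) blast
  then have "(1 - threshold lam)\<^sup>2 < 1\<^sup>2" using zero_less_power[of y0 2] unfolding one_power2 by linarith
  then have "\<bar>1 - threshold lam\<bar> < 1" by (metis abs_one abs_square_less_1 one_power2)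
  then show ?thesis by linarith
qed

text \<open>On the half circle z decreases with the angle, so z < z0 means \<theta>0 < \<theta> and
  the claim is sin (\<theta>0 - \<theta>) < 0. Comparing squares according to the signs of z and z0
  avoids the angles.\<close>

lemma half_circle_order:
  fixes y z y0 z0 :: real
  assumes "y \<ge> 0" "y0 > 0" "z\<^sup>2 + y\<^sup>2 = 1" "z0\<^sup>2 + y0\<^sup>2 = 1" "z < z0"
  shows "y0 * z < z0 * y"
proof (cases "0 \<le> z")
  case True
  then have "z\<^sup>2 < z0\<^sup>2" using assms by (intro power_strict_mono) auto
  then have "y0\<^sup>2 < y\<^sup>2" using assms by linarith
  then have "y0 < y" using assms by (metis power2_less_imp_less)
  have "y0 * z \<le> y * z" using True \<open>y0 < y\<close> by (intro mult_right_mono) auto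
  also have "\<dots> < z0 * y" using assms \<open>y0 < y\<close> by (simp add: mult.commute)
  finally show ?thesis .
next
  case False
  then have neg: "y0 * z < 0" using assms by (simp add: mult_pos_neg)
  show ?thesis
  proof (cases "z0 \<ge> 0")
    case True
    then have "z0 * y \<ge> 0" using assms by simp
    then show ?thesis using neg by linarith
  next
    case z0: False
    then have "(- z0)\<^sup>2 < (- z)\<^sup>2" using assms by (intro power_strict_mono) auto
    then have "y\<^sup>2 < y0\<^sup>2" using assms by simp
    then have "y < y0" using assms by (metis power2_less_imp_less less_imp_le)
    have "y0 * z < y0 * z0" using assms by simp
    also have "\<dots> \<le> y * z0" using z0 \<open>y < y0\<close> by (intro mult_right_mono_neg) auto
    finally show ?thesis by (simp add: mult.commute)
  qed
qed

lemma sqrt_half_circle: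
  fixes d :: real
  assumes "(2 - d) * d \<ge> 0"
  shows "(1 - d)\<^sup>2 + (sqrt ((2 - d) * d))\<^sup>2 = 1"
  using assms by (simp add: power2_eq_square algebra_simps)

text \<open>\<open>sqrt\<close> is total and negative at negative arguments, so
  \<open>threshold_eq\<close> has its intended meaning only under this condition.\<close>

lemma threshold_dom: 
  assumes "lam > 0" shows "(2 - threshold lam) * threshold lam \<ge> 0"
proof (cases "sin (lam * w lam 1) = 0")
  case True then show ?thesis by (simp add: threshold_def)
next
  case False
  obtain K y0 where "y0 > 0" "(1 - threshold lam)\<^sup>2 + y0\<^sup>2 = 1"
    by (rule drift_factorization[OF assms False]) blast
  then have "(2 - threshold lam) * threshold lam = y0\<^sup>2" by algebra
  then show ?thesis by simp
qed

lemma threshold_eq_iff: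
  assumes lam: "lam > 0" and s: "sin (lam * w lam 1) \<noteq> 0" and d: "(2 - d) * d \<ge> 0"
  shows "threshold_eq lam d \<longleftrightarrow> d = threshold lam"
proof -
  obtain K y0 where K: "K > 0" "y0 > 0" "(1 - threshold lam)\<^sup>2 + y0\<^sup>2 = 1"
    and f: "\<And>y z. - (sin (2 * lam * w lam 1) / (lam * w lam 1)) * y
        + 2 * (sin (lam * w lam 1))\<^sup>2 / (w lam 1)\<^sup>2 * z
      = K * (y0 * z - (1 - threshold lam) * y)"
    by (rule drift_factorization[OF lam s]) blast
  define z0 z y where "z0 = 1 - threshold lam" and "z = 1 - d" and "y = sqrt ((2 - d) * d)"
  have y: "y \<ge> 0" "z\<^sup>2 + y\<^sup>2 = 1" using sqrt_half_circle[OF d] d by (auto simp: z_def y_def)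
  have z0: "z0\<^sup>2 + y0\<^sup>2 = 1" using K by (simp add: z0_def)
  have "threshold_eq lam d \<longleftrightarrow> y0 * z = z0 * y"
    unfolding threshold_eq_def f using K by (auto simp: z0_def z_def y_def)
  also have "\<dots> \<longleftrightarrow> z = z0"
  proof
    assume eq: "y0 * z = z0 * y"
    \<comment> \<open>Strict positivity of y allows \<open>half_circle_order\<close> to be applied
      also with the two points exchanged.\<close>
    have "y \<noteq> 0"
    proof
      assume "y = 0"
      then have "z = 0" using eq K by simp
      then show False using y \<open>y = 0\<close> by simp
    qed
    then have "y > 0" using y by simp
    show "z = z0"
      using half_circle_order[OF y(1) K(2) y(2) z0] half_circle_order[OF _ \<open>y > 0\<close> z0 y(2)] K(2) eq
      by (cases z z0 rule: linorder_cases) (auto simp: mult.commute)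
  next
    assume "z = z0"
    moreover have "y = y0" using y z0 K \<open>z = z0\<close> by (metis add_left_cancel less_imp_le power2_eq_imp_eq)
    ultimately show "y0 * z = z0 * y" by simp
  qed
  finally show ?thesis by (auto simp: z_def z0_def)
qed

lemma threshold_eq_threshold: "lam > 0 \<Longrightarrow> threshold_eq lam (threshold lam)"
proof (cases "sin (lam * w lam 1) = 0")
  case True then show ?thesis by (simp add: threshold_eq_def threshold_def)
next
  case False
  then show "lam > 0 \<Longrightarrow> ?thesis" using threshold_eq_iff threshold_dom by blast
qed

lemma lyap_drift_neg:
  assumes lam: "lam > 0" and \<rho>: "\<rho> \<in> S1" and z: "rtr (\<rho> ** sigma_z) < 1 - threshold lam"
  shows "lyap_drift lam \<rho> < 0"
proof (cases "sin (lam * w lam 1) = 0")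
  \<comment> \<open>The threshold is 2, so the hypothesis would put z below -1.\<close>
  case True
  then show ?thesis using z S1_z_bounds(1)[OF \<rho>] by (simp add: threshold_def)
next
  case False
  obtain K y0 where K: "K > 0" "y0 > 0" "(1 - threshold lam)\<^sup>2 + y0\<^sup>2 = 1"
    and f: "\<And>y z. - (sin (2 * lam * w lam 1) / (lam * w lam 1)) * y
        + 2 * (sin (lam * w lam 1))\<^sup>2 / (w lam 1)\<^sup>2 * z
      = K * (y0 * z - (1 - threshold lam) * y)"
    by (rule drift_factorization[OF lam False]) blast
  obtain x z where \<rho>_eq: "\<rho> = bloch 1 x z" and xz: "x\<^sup>2 + z\<^sup>2 = 1" using \<rho> by (rule S1_cases)
  have "y0 * z < (1 - threshold lam) * \<bar>x\<bar>"
    using half_circle_order[of "\<bar>x\<bar>" y0 z "1 - threshold lam"] K xz z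
    by (simp add: \<rho>_eq rtr_bloch_sigma_z add.commute)
  then show ?thesis
    unfolding lyap_drift_def f using K by (simp add: \<rho>_eq rtr_bloch_sigma_z rtr_bloch_sigma_x mult_pos_neg)
qed

section \<open>Size of the threshold for small time steps\<close>

lemma threshold_tendsto_0: "(threshold \<longlongrightarrow> 0) (at_right 0)"
proof -
  have "((\<lambda>lam. 1 - cos (lam * w lam 1) * w lam 1 /
      sqrt ((cos (lam * w lam 1) * w lam 1)\<^sup>2 + (lam * sin (lam * w lam 1))\<^sup>2)) \<longlongrightarrow> 0) (at_right 0)"
    unfolding w_def by (auto intro!: tendsto_eq_intros)
  moreover have "\<forall>\<^sub>F lam in at_right 0. 1 - cos (lam * w lam 1) * w lam 1 /
      sqrt ((cos (lam * w lam 1) * w lam 1)\<^sup>2 + (lam * sin (lam * w lam 1))\<^sup>2) = threshold lam"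
    \<comment> \<open>For \<lambda> < 1 the argument \<lambda> w is at most 2 < pi, so the sine is
      positive and its sign drops out of \<open>threshold\<close>.\<close>
    using eventually_at_right_real[of 0 1, OF zero_less_one]
  proof eventually_elim
    case (elim lam)
    have "lam\<^sup>2 \<le> 1" using elim by (simp add: power_le_one)
    then have "w lam 1 \<le> sqrt (2\<^sup>2)" unfolding w_def by (intro real_sqrt_le_mono) simp
    then have "w lam 1 \<le> 2" by simp
    then have "lam * w lam 1 \<le> 1 * 2" using elim w_pos[of lam 1] by (intro mult_mono) auto
    then have "lam * w lam 1 < pi" using pi_gt3 by linarith
    then have "sin (lam * w lam 1) > 0" using elim w_pos[of lam 1] by (intro sin_gt_zero) auto
    then show ?case by (simp add: threshold_def Let_def)
  qed
  ultimately show ?thesis by (rule Lim_transform_eventually)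
qed

text \<open>With x = \<lambda> W, \<delta> is close to (\<lambda> tan x / W)^2 / 2, hence to
  \<lambda>^4 / 2 = 1 / 180000, about 5.56e-6. The bounds x cos x <= sin x <= x and cos x >= 1 - x^2
  / 2 are sharp enough for the window from 5.55e-6 to 5.65e-6.\<close>

lemma threshold_numeric:
  assumes lam: "lam > 0" and eq: "1 / lam\<^sup>2 = 300"
  shows "\<bar>threshold lam - 5.6 / 10 ^ 6\<bar> < 0.05 / 10 ^ 6"
proof -
  define W where "W = w lam 1"
  define x where "x = lam * W"
  define S C where "S = sin x" and "C = cos x"
  have l2: "lam\<^sup>2 = 1 / 300" using eq by (simp add: field_split_simps split: if_splits)
  have W: "W > 0" "W\<^sup>2 = 301 / 300" using w_pos w_sq[of lam 1] by (auto simp: W_def l2)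
  have x: "x > 0" "x\<^sup>2 = 301 / 90000" using lam W by (auto simp: x_def power_mult_distrib l2)
  have "x\<^sup>2 < 1\<^sup>2" using x(2) by simp
  then have x1: "x < 1" by (rule power2_less_imp_less) simp
  have C1: "C \<ge> 1 - 301 / 180000"
  proof -
    have "(sin (x / 2))\<^sup>2 \<le> (x / 2)\<^sup>2"
      using abs_sin_x_le_abs_x[of "x / 2"] by (simp only: abs_le_square_iff)
    then show ?thesis
      using cos_double_sin[of "x / 2"] by (simp add: C_def power_divide x(2))
  qed
  then have C0: "C > 0" by linarith
  have S: "S > 0" "S \<le> x" unfolding S_def using x x1 pi_gt3 by (auto intro!: sin_gt_zero sin_x_le_x)
  have SC: "x * C \<le> S"
  proof -
    obtain y where y: "0 < y" "y < x" "sin x - sin 0 = (x - 0) * cos y"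
      using MVT2[OF x(1), of sin cos] by (auto intro: DERIV_sin)
    moreover have "cos x \<le> cos y" using y x1 pi_gt3 by (intro cos_monotone_0_pi_le) auto
    ultimately show ?thesis using x(1) by (simp add: S_def C_def)
  qed
  define r where "r = 1 - threshold lam"
  have r_eq: "r = C * W / sqrt ((C * W)\<^sup>2 + (lam * S)\<^sup>2)"
    using S(1) unfolding r_def threshold_def S_def C_def x_def W_def by (simp add: Let_def)
  then have r0: "r > 0" using C0 W lam S by (auto intro!: divide_pos_pos add_pos_pos)
  have pos: "(C * W)\<^sup>2 + (lam * S)\<^sup>2 > 0" using C0 W by (intro add_pos_nonneg) auto
  then have r2: "r\<^sup>2 = (C * W)\<^sup>2 / ((C * W)\<^sup>2 + (lam * S)\<^sup>2)"
    unfolding r_eq power_divide by simp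
  have CW: "(C * W)\<^sup>2 = C\<^sup>2 * (301 / 300)" "(lam * S)\<^sup>2 = S\<^sup>2 / 300"
    by (simp_all add: power_mult_distrib W(2) l2)
  have "(x * C)\<^sup>2 \<le> S\<^sup>2" using SC x C0 by (intro power_mono) auto
  then have S2: "301 / 90000 * C\<^sup>2 \<le> S\<^sup>2" by (simp add: power_mult_distrib x(2))
  have S2': "S\<^sup>2 \<le> 301 / 90000" using S power_mono[of S x 2] by (simp flip: x(2))
  have C2: "(1 - 301 / 180000)\<^sup>2 \<le> C\<^sup>2" using C1 by (intro power_mono) auto
  have "r\<^sup>2 < (1 - 5.55 / 10 ^ 6)\<^sup>2"
    unfolding r2 pos_divide_less_eq[OF pos] unfolding CW using S2 C2 by (simp add: power2_eq_square)
  then have "r < 1 - 5.55 / 10 ^ 6" by (rule power2_less_imp_less) simp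
  moreover have "(1 - 5.65 / 10 ^ 6)\<^sup>2 < r\<^sup>2"
    unfolding r2 pos_less_divide_eq[OF pos] unfolding CW using S2' C2 by (simp add: power2_eq_square)
  then have "1 - 5.65 / 10 ^ 6 < r" by (rule power2_less_imp_less) (use r0 in simp)
  ultimately show ?thesis unfolding r_def abs_less_iff by simp
qed

section \<open>The controlled filter as a stochastic process\<close>

lemma borel_measurable_matrix_mult [measurable]:
  fixes f g :: "'a \<Rightarrow> cmat2"
  assumes "f \<in> borel_measurable M" "g \<in> borel_measurable M"
  shows "(\<lambda>x. f x ** g x) \<in> borel_measurable M"
proof (rule borel_measurable_continuous_Pair[OF assms])
  show "continuous_on UNIV (\<lambda>p. (fst p :: cmat2) ** (snd p :: cmat2))"
    unfolding matrix_matrix_mult_def by (intro continuous_intros)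
qed

lemma borel_measurable_rtr [measurable]: "rtr \<in> borel_measurable borel"
proof (rule borel_measurable_continuous_onI)
  show "continuous_on UNIV rtr"
    unfolding rtr_def trace_def sum_2 by (intro continuous_intros)
qed

lemma borel_measurable_V [measurable]: "V \<in> borel_measurable borel"
  unfolding V_def by measurable

lemma borel_measurable_vdrift [measurable]: "vdrift lam \<delta> \<in> borel_measurable borel"
  unfolding vdrift_def lyap_drift_def by measurable

lemma borel_measurable_filter_step [measurable]:
  "(\<lambda>\<rho>. filter_step lam \<rho> u dy) \<in> borel_measurable borel"
  unfolding filter_step_def Lbar_def Jbar_def by measurable

definition fb_step :: "real \<Rightarrow> real \<Rightarrow> real \<Rightarrow> cmat2 \<Rightarrow> cmat2" where
  "fb_step lam \<delta> dy \<rho> = filter_step lam \<rho> (feedback \<delta> \<rho>) dy"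

text \<open>\<open>feedback\<close> takes three values, so measurability of the step for each fixed
  control is enough.\<close>

lemma borel_measurable_fb_step [measurable]: "fb_step lam \<delta> dy \<in> borel_measurable borel"
proof -
  have "fb_step lam \<delta> dy = (\<lambda>\<rho>. if rtr (\<rho> ** sigma_z) \<ge> 1 - \<delta> then filter_step lam \<rho> 0 dy
      else if rtr (\<rho> ** (sigma_plus + sigma_minus)) < 0 then filter_step lam \<rho> (- 1) dy
      else filter_step lam \<rho> 1 dy)"
    by (auto simp: fb_step_def feedback_def)
  then show ?thesis by simp
qed

lemma V_bounds: "\<rho> \<in> S1 \<Longrightarrow> 0 \<le> V \<rho>" "\<rho> \<in> S1 \<Longrightarrow> V \<rho> \<le> 2"
  using S1_z_bounds[of \<rho>] by (simp_all add: V_def)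

section \<open>The filter as an adapted process on the circle\<close>

locale controlled_filter = prob_space M for M :: "'a measure" +
  fixes lam \<delta> :: real and \<rho>0 :: cmat2 and dy :: "nat \<Rightarrow> 'a \<Rightarrow> real" and \<rho> :: "nat \<Rightarrow> 'a \<Rightarrow> cmat2"
  assumes lam_pos: "lam > 0" and init: "\<rho>0 \<in> S1"
    and filter: "homodyne_filter M lam (feedback \<delta>) \<rho>0 dy \<rho>"
begin

lemma dy_measurable: "1 \<le> l \<Longrightarrow> dy l \<in> borel_measurable M"
  and dy_range: "1 \<le> l \<Longrightarrow> \<omega> \<in> space M \<Longrightarrow> dy l \<omega> \<in> {lam, - lam}"
  using filter unfolding homodyne_filter_def by auto

lemma state_0: "\<omega> \<in> space M \<Longrightarrow> \<rho> 0 \<omega> = \<rho>0"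
  using filter unfolding homodyne_filter_def by auto

lemma state_Suc: "\<omega> \<in> space M \<Longrightarrow> \<rho> (Suc l) \<omega> = fb_step lam \<delta> (dy (Suc l) \<omega>) (\<rho> l \<omega>)"
  using filter unfolding homodyne_filter_def fb_step_def
  by (metis diff_Suc_1 le_add1 plus_1_eq_Suc)

lemma state_S1: "\<omega> \<in> space M \<Longrightarrow> \<rho> l \<omega> \<in> S1"
proof (induction l)
  case 0 then show ?case by (simp add: state_0 init)
next
  case (Suc l)
  then show ?case
    unfolding state_Suc[OF Suc.prems] fb_step_def
    using lam_pos dy_range[of "Suc l"] by (intro filter_step_S1) auto
qed

lemma fb_step_S1: "\<omega> \<in> space M \<Longrightarrow> e \<in> {lam, - lam} \<Longrightarrow> fb_step lam \<delta> e (\<rho> l \<omega>) \<in> S1"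
  unfolding fb_step_def using lam_pos by (intro filter_step_S1 state_S1) auto

abbreviation obs :: "nat \<Rightarrow> 'a measure" where "obs \<equiv> obs_algebra M dy"
abbreviation state_algebra :: "nat \<Rightarrow> 'a measure" where
  "state_algebra l \<equiv> vimage_algebra (space M) (\<rho> l) borel"

lemma space_obs [simp]: "space (obs n) = space M"
  by (simp add: obs_algebra_def)

lemma subalgebra_obs: "subalgebra M (obs n)"
proof -
  have "(\<lambda>\<omega>. \<lambda>i\<in>{1..n}. dy i \<omega>) \<in> measurable M (Pi\<^sub>M {1..n} (\<lambda>_. borel))"
    by (intro measurable_restrict dy_measurable) auto
  then show ?thesis
    unfolding subalgebra_def
    by (auto simp: obs_algebra_def dest: sets_image_in_sets[rotated])
qed

lemma dy_obs: "1 \<le> i \<Longrightarrow> i \<le> n \<Longrightarrow> dy i \<in> borel_measurable (obs n)"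
proof -
  assume i: "1 \<le> i" "i \<le> n"
  have "(\<lambda>\<omega>. \<lambda>i\<in>{1..n}. dy i \<omega>) \<in> measurable (obs n) (Pi\<^sub>M {1..n} (\<lambda>_. borel))"
    unfolding obs_algebra_def
    by (rule measurable_vimage_algebra1) (auto simp: space_PiM)
  then have "(\<lambda>\<omega>. (\<lambda>i\<in>{1..n}. dy i \<omega>) i) \<in> borel_measurable (obs n)"
    by (rule measurable_compose) (use i in simp)
  then show ?thesis using i by simp
qed

text \<open>The state is a function of the observations so far. As \<open>dy\<close> has two values,
  the recursion is a case distinction between two measurable maps.\<close>

lemma state_obs: "l \<le> n \<Longrightarrow> \<rho> l \<in> borel_measurable (obs n)"
proof (induction l)
  case 0
  have "(\<lambda>_. \<rho>0) \<in> borel_measurable (obs n)" by simp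
  then show ?case by (subst measurable_cong[where g = "\<lambda>_. \<rho>0"]) (simp_all add: state_0)
next
  case (Suc l)
  have [measurable]: "\<rho> l \<in> borel_measurable (obs n)" "dy (Suc l) \<in> borel_measurable (obs n)"
    using Suc dy_obs by auto
  have "(\<lambda>\<omega>. if dy (Suc l) \<omega> = lam then fb_step lam \<delta> lam (\<rho> l \<omega>) else fb_step lam \<delta> (- lam) (\<rho> l \<omega>))
      \<in> borel_measurable (obs n)"
    by measurable
  then show ?case
    by (subst measurable_cong[where g = "\<lambda>\<omega>. if dy (Suc l) \<omega> = lam then fb_step lam \<delta> lam (\<rho> l \<omega>)
         else fb_step lam \<delta> (- lam) (\<rho> l \<omega>)"]) (use dy_range[of "Suc l"] in \<open>force simp: state_Suc\<close>)+
qed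

lemma state_measurable [measurable]: "\<rho> l \<in> borel_measurable M"
  using measurable_from_subalg[OF subalgebra_obs state_obs[OF order_refl]] .

lemma subalgebra_state: "subalgebra (obs l) (state_algebra l)"
  unfolding subalgebra_def
  using sets_image_in_sets[OF _ state_obs[of l l]] by simp

lemma subalgebra_state_M: "subalgebra M (state_algebra l)"
  using subalgebra_obs[of l] subalgebra_state[of l] by (auto simp: subalgebra_def)

section \<open>Conditional expectation of the increment of V\<close>

lemma sigma_finite_subalgebra_of: "subalgebra M F \<Longrightarrow> sigma_finite_subalgebra M F"
  by (intro finite_measure_subalgebra_is_sigma_finite finite_measure_subalgebra.intro
      finite_measure_subalgebra_axioms.intro finite_measure_axioms)

lemma integrable_V_state: "integrable M (\<lambda>\<omega>. V (\<rho> l \<omega>))"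
  by (rule integrable_const_bound[of _ 2]) (auto simp: V_bounds state_S1)

text \<open>V of the next state is split over the two outcomes into
  \<open>f e * indicator (A e)\<close>. Each \<open>f e\<close> is known after l observations and
  can be pulled out; what remains are the outcome probabilities of the model, and
  \<open>mean_V_filter_step\<close> evaluates the weighted sum.\<close>

lemma cond_exp_increment_obs:
  "AE \<omega> in M. real_cond_exp M (obs l) (\<lambda>\<omega>. V (\<rho> (Suc l) \<omega>) - V (\<rho> l \<omega>)) \<omega> = vdrift lam \<delta> (\<rho> l \<omega>)"
proof -
  interpret G: sigma_finite_subalgebra M "obs l"
    by (rule sigma_finite_subalgebra_of[OF subalgebra_obs])
  note [measurable] = state_obs[of l l, OF order_refl] dy_measurable[of "Suc l", simplified]
  define A where "A e = {\<omega> \<in> space M. dy (Suc l) \<omega> = e}" for e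
  have A [measurable]: "A e \<in> sets M" for e unfolding A_def by measurable
  define f where "f e \<omega> = V (fb_step lam \<delta> e (\<rho> l \<omega>))" for e \<omega>
  have f_obs [measurable]: "f e \<in> borel_measurable (obs l)" for e unfolding f_def by measurable
  have f_M [measurable]: "f e \<in> borel_measurable M" for e unfolding f_def by measurable
  have f_int: "integrable M (\<lambda>\<omega>. f e \<omega> * indicator (A e) \<omega>)" if "e \<in> {lam, - lam}" for e
    by (rule integrable_const_bound[of _ 2])
      (use that in \<open>auto simp: f_def V_bounds fb_step_S1 abs_mult indicator_def\<close>)
  let ?g = "\<lambda>\<omega>. f lam \<omega> * indicator (A lam) \<omega> + f (- lam) \<omega> * indicator (A (- lam)) \<omega>"
  have "AE \<omega> in M. V (\<rho> (Suc l) \<omega>) - V (\<rho> l \<omega>) = ?g \<omega> - V (\<rho> l \<omega>)"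
    using AE_space
  proof eventually_elim
    case (elim \<omega>)
    then show ?case using dy_range[of "Suc l" \<omega>] lam_pos
      by (auto simp: state_Suc A_def f_def)
  qed
  then have e1: "AE \<omega> in M. real_cond_exp M (obs l) (\<lambda>\<omega>. V (\<rho> (Suc l) \<omega>) - V (\<rho> l \<omega>)) \<omega>
      = real_cond_exp M (obs l) (\<lambda>\<omega>. ?g \<omega> - V (\<rho> l \<omega>)) \<omega>"
    by (rule G.real_cond_exp_cong) measurable
  have e2: "AE \<omega> in M. real_cond_exp M (obs l) (\<lambda>\<omega>. ?g \<omega> - V (\<rho> l \<omega>)) \<omega>
      = real_cond_exp M (obs l) ?g \<omega> - real_cond_exp M (obs l) (\<lambda>\<omega>. V (\<rho> l \<omega>)) \<omega>"
    using f_int by (intro G.real_cond_exp_diff integrable_V_state Bochner_Integration.integrable_add) auto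
  have e3: "AE \<omega> in M. real_cond_exp M (obs l) (\<lambda>\<omega>. V (\<rho> l \<omega>)) \<omega> = V (\<rho> l \<omega>)"
    by (intro G.real_cond_exp_F_meas integrable_V_state) measurable
  have e4: "AE \<omega> in M. real_cond_exp M (obs l) ?g \<omega>
      = real_cond_exp M (obs l) (\<lambda>\<omega>. f lam \<omega> * indicator (A lam) \<omega>) \<omega>
      + real_cond_exp M (obs l) (\<lambda>\<omega>. f (- lam) \<omega> * indicator (A (- lam)) \<omega>) \<omega>"
    using f_int by (intro G.real_cond_exp_add) auto
  have mult: "AE \<omega> in M. real_cond_exp M (obs l) (\<lambda>\<omega>. f e \<omega> * indicator (A e) \<omega>) \<omega>
      = f e \<omega> * real_cond_exp M (obs l) (indicator (A e)) \<omega>" if "e \<in> {lam, - lam}" for e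
    by (rule G.real_cond_exp_mult[OF f_obs _ f_int[OF that]]) measurable
  have p: "AE \<omega> in M. real_cond_exp M (obs l) (indicator (A lam)) \<omega>
           = 1/2 + lam / 2 * rtr (Jbar lam (\<rho> l \<omega>) (feedback \<delta> (\<rho> l \<omega>)))"
    "AE \<omega> in M. real_cond_exp M (obs l) (indicator (A (- lam))) \<omega>
           = 1/2 - lam / 2 * rtr (Jbar lam (\<rho> l \<omega>) (feedback \<delta> (\<rho> l \<omega>)))"
    using filter[unfolded homodyne_filter_def, THEN conjunct2, THEN conjunct2, THEN conjunct2,
        THEN conjunct2, rule_format, of "Suc l"] by (simp_all add: A_def)
  from e1 e2 e3 e4 mult[OF insertI1] mult[OF insertI2, OF singletonI] p AE_space show ?thesis
  proof eventually_elim
    case (elim \<omega>)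
    show ?case
      unfolding elim(1-8) unfolding f_def fb_step_def
      using mean_V_filter_step[OF _ state_S1[OF \<open>\<omega> \<in> space M\<close>], of lam l \<delta>] lam_pos by (simp add: algebra_simps)
  qed
qed

text \<open>Taking expectations makes the drifts telescope.\<close>

lemma integrable_vdrift: "integrable M (\<lambda>\<omega>. vdrift lam \<delta> (\<rho> l \<omega>))"
  and integral_vdrift: "(\<integral>\<omega>. vdrift lam \<delta> (\<rho> l \<omega>) \<partial>M) = (\<integral>\<omega>. V (\<rho> (Suc l) \<omega>) \<partial>M) - (\<integral>\<omega>. V (\<rho> l \<omega>) \<partial>M)"
proof -
  interpret G: sigma_finite_subalgebra M "obs l"
    by (rule sigma_finite_subalgebra_of[OF subalgebra_obs])
  let ?f = "\<lambda>\<omega>. V (\<rho> (Suc l) \<omega>) - V (\<rho> l \<omega>)"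
  have f: "integrable M ?f" by (intro Bochner_Integration.integrable_diff integrable_V_state)
  have m: "real_cond_exp M (obs l) ?f \<in> borel_measurable M" by simp
  show "integrable M (\<lambda>\<omega>. vdrift lam \<delta> (\<rho> l \<omega>))"
    by (rule integrable_cong_AE_imp[OF G.real_cond_exp_int(1)[OF f]]) (use cond_exp_increment_obs in auto)
  have "(\<integral>\<omega>. vdrift lam \<delta> (\<rho> l \<omega>) \<partial>M) = (\<integral>\<omega>. real_cond_exp M (obs l) ?f \<omega> \<partial>M)"
    by (rule integral_cong_AE) (use cond_exp_increment_obs in \<open>auto simp: eq_commute\<close>)
  also have "\<dots> = (\<integral>\<omega>. ?f \<omega> \<partial>M)" by (rule G.real_cond_exp_int(2)[OF f])
  finally show "(\<integral>\<omega>. vdrift lam \<delta> (\<rho> l \<omega>) \<partial>M) = (\<integral>\<omega>. V (\<rho> (Suc l) \<omega>) \<partial>M) - (\<integral>\<omega>. V (\<rho> l \<omega>) \<partial>M)"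
    by (simp add: integrable_V_state)
qed

text \<open>The model gives probabilities conditioned on all past observations. Since the resulting
  drift depends on the last state alone, the tower property carries it over to the smaller
  \<sigma>-algebra.\<close>

lemma cond_exp_increment:
  "AE \<omega> in M. real_cond_exp M (state_algebra l) (\<lambda>\<omega>. V (\<rho> (Suc l) \<omega>) - V (\<rho> l \<omega>)) \<omega>
     = vdrift lam \<delta> (\<rho> l \<omega>)"
proof -
  interpret G: sigma_finite_subalgebra M "obs l"
    by (rule sigma_finite_subalgebra_of[OF subalgebra_obs])
  interpret F: sigma_finite_subalgebra M "state_algebra l"
    by (rule sigma_finite_subalgebra_of[OF subalgebra_state_M])
  let ?f = "\<lambda>\<omega>. V (\<rho> (Suc l) \<omega>) - V (\<rho> l \<omega>)"
  have f: "integrable M ?f" by (intro Bochner_Integration.integrable_diff integrable_V_state)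
  have [measurable]: "\<rho> l \<in> borel_measurable (state_algebra l)"
    by (rule measurable_vimage_algebra1) simp
  have "AE \<omega> in M. real_cond_exp M (state_algebra l) (real_cond_exp M (obs l) ?f) \<omega>
      = real_cond_exp M (state_algebra l) ?f \<omega>"
    by (rule F.real_cond_exp_nested_subalg[OF subalgebra_obs subalgebra_state f])
  moreover have "AE \<omega> in M. real_cond_exp M (state_algebra l) (real_cond_exp M (obs l) ?f) \<omega>
      = real_cond_exp M (state_algebra l) (\<lambda>\<omega>. vdrift lam \<delta> (\<rho> l \<omega>)) \<omega>"
    by (rule F.real_cond_exp_cong[OF cond_exp_increment_obs]) auto
  moreover have "AE \<omega> in M. real_cond_exp M (state_algebra l) (\<lambda>\<omega>. vdrift lam \<delta> (\<rho> l \<omega>)) \<omega>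
      = vdrift lam \<delta> (\<rho> l \<omega>)"
    by (rule F.real_cond_exp_F_meas[OF integrable_vdrift]) measurable
  ultimately show ?thesis by eventually_elim simp
qed

section \<open>Almost sure limit\<close>

lemma AE_vdrift_tendsto_0:
  assumes neg: "\<And>r. r \<in> S1 \<Longrightarrow> vdrift lam \<delta> r \<le> 0"
  shows "AE \<omega> in M. (\<lambda>l. vdrift lam \<delta> (\<rho> l \<omega>)) \<longlonglongrightarrow> 0"
proof -
  let ?d = "\<lambda>l \<omega>. - vdrift lam \<delta> (\<rho> l \<omega>)"
  have nonneg: "\<omega> \<in> space M \<Longrightarrow> ?d l \<omega> \<ge> 0" for l \<omega> using neg state_S1 by simp
  have sum: "(\<Sum>l<n. \<integral>\<omega>. ?d l \<omega> \<partial>M) = (\<integral>\<omega>. V (\<rho> 0 \<omega>) \<partial>M) - (\<integral>\<omega>. V (\<rho> n \<omega>) \<partial>M)" for n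
    by (induction n) (simp_all add: integral_vdrift)
  have bound: "(\<Sum>l<n. \<integral>\<omega>. ?d l \<omega> \<partial>M) \<le> 2" for n
  proof -
    have "(\<integral>\<omega>. V (\<rho> 0 \<omega>) \<partial>M) \<le> 2"
      by (rule integral_le_const[OF integrable_V_state]) (auto simp: V_bounds state_S1)
    moreover have "(\<integral>\<omega>. V (\<rho> n \<omega>) \<partial>M) \<ge> 0"
      by (rule integral_nonneg_AE) (auto simp: V_bounds state_S1)
    ultimately show ?thesis unfolding sum by linarith
  qed
  \<comment> \<open>In \<open>ennreal\<close> the series of decrements exists before its convergence
    is known, and sum and integral may be exchanged. Finite expectation makes it finite almost
    surely, so its terms tend to 0.\<close>
  have "(\<integral>\<^sup>+\<omega>. (\<Sum>l. ennreal (?d l \<omega>)) \<partial>M) = (\<Sum>l. \<integral>\<^sup>+\<omega>. ennreal (?d l \<omega>) \<partial>M)"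
    by (rule nn_integral_suminf) measurable
  also have "\<dots> = (\<Sum>l. ennreal (\<integral>\<omega>. ?d l \<omega> \<partial>M))"
    by (intro suminf_cong nn_integral_eq_integral AE_I2 nonneg) (auto simp: integrable_vdrift)
  also have "\<dots> \<le> ennreal 2"
  proof (rule suminf_le_const[OF summableI])
    fix n
    have "(\<Sum>l<n. ennreal (\<integral>\<omega>. ?d l \<omega> \<partial>M)) = ennreal (\<Sum>l<n. \<integral>\<omega>. ?d l \<omega> \<partial>M)"
      by (rule sum_ennreal) (intro integral_nonneg_AE AE_I2 nonneg)
    also have "\<dots> \<le> ennreal 2" by (rule ennreal_leI[OF bound])
    finally show "(\<Sum>l<n. ennreal (\<integral>\<omega>. ?d l \<omega> \<partial>M)) \<le> ennreal 2" .
  qed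
  finally have "(\<integral>\<^sup>+\<omega>. (\<Sum>l. ennreal (?d l \<omega>)) \<partial>M) \<noteq> \<infinity>"
    by (metis ennreal_neq_top infinity_ennreal_def top.extremum_unique)
  then have "AE \<omega> in M. (\<Sum>l. ennreal (?d l \<omega>)) \<noteq> \<infinity>"
    by (intro nn_integral_PInf_AE) measurable
  then show ?thesis
    using AE_space
  proof eventually_elim
    case (elim \<omega>)
    then have "summable (\<lambda>l. ?d l \<omega>)"
      by (intro summable_suminf_not_top nonneg) auto
    then have "(\<lambda>l. ?d l \<omega>) \<longlonglongrightarrow> 0" by (rule summable_LIMSEQ_zero)
    from tendsto_minus[OF this] show ?case by simp
  qed
qed

end

text \<open>On the circle |x| = sqrt (1 - z^2), so the drift is a function of z alone. \<phi> omits
  the case distinction at the threshold and is therefore continuous on a compact interval of z,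
  where it attains its supremum.\<close>

lemma vdrift_uniformly_neg:
  assumes lam: "lam > 0" and neg: "\<And>r. r \<in> S1 \<Longrightarrow> rtr (r ** sigma_z) < 1 - \<delta> \<Longrightarrow> lyap_drift lam r < 0"
    and a: "a < 1 - \<delta>"
  obtains m where "m > 0" "\<And>r. r \<in> S1 \<Longrightarrow> rtr (r ** sigma_z) \<le> a \<Longrightarrow> vdrift lam \<delta> r \<le> - m"
proof -
  define \<phi> where "\<phi> z = lam\<^sup>2 * lyap_drift lam (bloch 1 (sqrt (1 - z\<^sup>2)) z)" for z
  have \<phi>: "vdrift lam \<delta> r = \<phi> (rtr (r ** sigma_z)) \<and> \<phi> (rtr (r ** sigma_z)) < 0"
    if r: "r \<in> S1" "rtr (r ** sigma_z) \<le> a" for r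
  proof -
    obtain x z where r_eq: "r = bloch 1 x z" and xz: "x\<^sup>2 + z\<^sup>2 = 1" using r(1) by (rule S1_cases)
    have "sqrt (1 - z\<^sup>2) = \<bar>x\<bar>" using xz by (metis add_diff_cancel_right' real_sqrt_abs)
    then have "\<phi> z = vdrift lam \<delta> r"
      using r(2) a by (simp add: \<phi>_def vdrift_def lyap_drift_def r_eq rtr_bloch_sigma_z rtr_bloch_sigma_x)
    moreover have "vdrift lam \<delta> r < 0"
      using neg[OF r(1)] r(2) a lam by (simp add: vdrift_def mult_pos_neg)
    ultimately show ?thesis by (simp add: r_eq rtr_bloch_sigma_z)
  qed
  show thesis
  proof (cases "- 1 \<le> a")
    \<comment> \<open>No state has z <= a < -1, so any m serves.\<close>
    case False
    then show thesis using that[of 1] S1_z_bounds(1) by force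
  next
    case True
    \<comment> \<open>\<delta> is arbitrary here and a may exceed 1; the cap keeps every z of the
      interval the coordinate of a state.\<close>
    have "continuous_on {-1..min a 1} \<phi>"
      unfolding \<phi>_def lyap_drift_def rtr_bloch_sigma_z rtr_bloch_sigma_x by (intro continuous_intros)
    then obtain z where z: "z \<in> {-1..min a 1}" "\<And>y. y \<in> {-1..min a 1} \<Longrightarrow> \<phi> y \<le> \<phi> z"
      using continuous_attains_sup[of "{-1..min a 1}" \<phi>] True by auto
    have "z\<^sup>2 \<le> 1" using z(1) by (simp add: abs_square_le_1 abs_le_iff)
    then have "bloch 1 (sqrt (1 - z\<^sup>2)) z \<in> S1" by (intro bloch_in_S1) simp
    then have "\<phi> z < 0" using \<phi>[of "bloch 1 (sqrt (1 - z\<^sup>2)) z"] z(1) by (simp add: rtr_bloch_sigma_z)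
    show thesis
    proof (rule that[of "- \<phi> z"])
      show "0 < - \<phi> z" using \<open>\<phi> z < 0\<close> by simp
    next
      fix r assume r: "r \<in> S1" "rtr (r ** sigma_z) \<le> a"
      then have "\<phi> (rtr (r ** sigma_z)) \<le> \<phi> z" using S1_z_bounds[OF r(1)] by (intro z) auto
      then show "vdrift lam \<delta> r \<le> - (- \<phi> z)" using \<phi>[OF r] by simp
    qed
  qed
qed

lemma (in controlled_filter) liminf_state:
  assumes neg: "\<And>r. r \<in> S1 \<Longrightarrow> rtr (r ** sigma_z) < 1 - \<delta> \<Longrightarrow> lyap_drift lam r < 0"
  shows "AE \<omega> in M. liminf (\<lambda>l. ereal (rtr (\<rho> l \<omega> ** sigma_z))) \<ge> ereal (1 - \<delta>)"
proof -
  have "AE \<omega> in M. (\<lambda>l. vdrift lam \<delta> (\<rho> l \<omega>)) \<longlonglongrightarrow> 0"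
  proof (rule AE_vdrift_tendsto_0)
    fix r assume "r \<in> S1"
    then show "vdrift lam \<delta> r \<le> 0"
      using neg by (auto simp: vdrift_def mult_le_0_iff intro: less_imp_le)
  qed
  from this AE_space show ?thesis
  proof eventually_elim
    case (elim \<omega>)
    have "\<forall>\<^sub>F l in sequentially. y < ereal (rtr (\<rho> l \<omega> ** sigma_z))" if y: "y < ereal (1 - \<delta>)" for y
    proof -
      \<comment> \<open>y is an extended real; the uniform bound needs a real level strictly below
        the threshold. Drifts above -m then force z > a.\<close>
      obtain a where a: "y < ereal a" "a < 1 - \<delta>"
        using ereal_dense2[OF y] by auto
      obtain m where m: "m > 0" "\<And>r. r \<in> S1 \<Longrightarrow> rtr (r ** sigma_z) \<le> a \<Longrightarrow> vdrift lam \<delta> r \<le> - m"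
        using vdrift_uniformly_neg[OF lam_pos neg a(2)] by blast
      have "\<forall>\<^sub>F l in sequentially. vdrift lam \<delta> (\<rho> l \<omega>) > - m"
        by (rule order_tendstoD(1)[OF elim(1)]) (use m in simp)
      then show ?thesis
      proof eventually_elim
        case (elim l)
        then have "a < rtr (\<rho> l \<omega> ** sigma_z)" using m(2)[OF state_S1[OF \<open>\<omega> \<in> space M\<close>], of l] by force
        then show ?case using a(1) by (metis ereal_less_eq(3) less_ereal.simps(1) order_less_trans)
      qed
    qed
    then show ?case by (simp add: le_Liminf_iff)
  qed
qed

text \<open>One function of \<lambda> is chosen before any filter. Uniqueness is restricted to
  nonzero sine because otherwise every d solves the equation. Smallness is expressed by the limit at
  0, and 5.6e-6 is read as correct to two digits.\<close>

theorem mainTheorem6: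
  "\<exists>\<delta> :: real \<Rightarrow> real.
     (\<forall>lam>0.
        \<delta> lam > 0 \<and>
        (\<forall>\<rho>\<in>S1. rtr (\<rho> ** sigma_z) < 1 - \<delta> lam \<longrightarrow> lyap_drift lam \<rho> < 0) \<and>
        (2 - \<delta> lam) * \<delta> lam \<ge> 0 \<and> threshold_eq lam (\<delta> lam) \<and>
        (sin (lam * w lam 1) \<noteq> 0 \<longrightarrow>
           (\<forall>d. (2 - d) * d \<ge> 0 \<and> threshold_eq lam d \<longrightarrow> d = \<delta> lam)) \<and>
        (\<forall>(M :: 'a measure) \<rho>0 dy \<rho>.
           \<rho>0 \<in> S1 \<and> homodyne_filter M lam (feedback (\<delta> lam)) \<rho>0 dy \<rho> \<longrightarrow>
             (\<forall>l. \<forall>\<omega>\<in>space M. \<rho> l \<omega> \<in> S1) \<and>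
             (\<forall>l\<ge>1. AE \<omega> in M.
                real_cond_exp M (vimage_algebra (space M) (\<rho> (l - 1)) borel)
                  (\<lambda>\<omega>. V (\<rho> l \<omega>) - V (\<rho> (l - 1) \<omega>)) \<omega> \<le> 0 \<and>
                (real_cond_exp M (vimage_algebra (space M) (\<rho> (l - 1)) borel)
                  (\<lambda>\<omega>. V (\<rho> l \<omega>) - V (\<rho> (l - 1) \<omega>)) \<omega> = 0 \<longrightarrow>
                 rtr (\<rho> (l - 1) \<omega> ** sigma_z) \<ge> 1 - \<delta> lam)) \<and>
             (AE \<omega> in M. liminf (\<lambda>l. ereal (rtr (\<rho> l \<omega> ** sigma_z))) \<ge> ereal (1 - \<delta> lam))) \<and>
        (1 / lam\<^sup>2 = 300 \<longrightarrow> \<bar>\<delta> lam - 5.6 / 10 ^ 6\<bar> < 0.05 / 10 ^ 6)) \<and>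
     (\<delta> \<longlongrightarrow> 0) (at_right 0)"
proof (intro exI[of _ threshold] conjI allI impI ballI)
  fix lam :: real assume lam: "lam > 0"
  show "threshold lam > 0" "(2 - threshold lam) * threshold lam \<ge> 0"
    "threshold_eq lam (threshold lam)"
    using lam by (rule threshold_pos threshold_dom threshold_eq_threshold)+
  show "lyap_drift lam \<rho> < 0" if "\<rho> \<in> S1" "rtr (\<rho> ** sigma_z) < 1 - threshold lam" for \<rho>
    using lam that by (rule lyap_drift_neg)
  show "d = threshold lam"
    if "sin (lam * w lam 1) \<noteq> 0" "(2 - d) * d \<ge> 0 \<and> threshold_eq lam d" for d
    using threshold_eq_iff lam that by blast
  show "\<bar>threshold lam - 5.6 / 10 ^ 6\<bar> < 0.05 / 10 ^ 6" if "1 / lam\<^sup>2 = 300"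
    using lam that by (rule threshold_numeric)
  fix M :: "'a measure" and \<rho>0 dy \<rho>
  assume filter: "\<rho>0 \<in> S1 \<and> homodyne_filter M lam (feedback (threshold lam)) \<rho>0 dy \<rho>"
  then interpret controlled_filter M lam "threshold lam" \<rho>0 dy \<rho>
    using lam by (simp add: controlled_filter_def controlled_filter_axioms_def homodyne_filter_def)
  show "\<rho> l \<omega> \<in> S1" if "\<omega> \<in> space M" for l \<omega>
    using that by (rule state_S1)
  show "AE \<omega> in M. liminf (\<lambda>l. ereal (rtr (\<rho> l \<omega> ** sigma_z))) \<ge> ereal (1 - threshold lam)"
    using lyap_drift_neg[OF lam] by (rule liminf_state)
  fix l :: nat assume "l \<ge> 1"
  then obtain k where l: "l = Suc k" by (cases l) auto
  show "AE \<omega> in M.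
      real_cond_exp M (vimage_algebra (space M) (\<rho> (l - 1)) borel)
        (\<lambda>\<omega>. V (\<rho> l \<omega>) - V (\<rho> (l - 1) \<omega>)) \<omega> \<le> 0 \<and>
      (real_cond_exp M (vimage_algebra (space M) (\<rho> (l - 1)) borel)
        (\<lambda>\<omega>. V (\<rho> l \<omega>) - V (\<rho> (l - 1) \<omega>)) \<omega> = 0 \<longrightarrow>
       rtr (\<rho> (l - 1) \<omega> ** sigma_z) \<ge> 1 - threshold lam)"
    unfolding l diff_Suc_1 using cond_exp_increment[of k] AE_space
  proof eventually_elim
    case (elim \<omega>)
    have "lam\<^sup>2 * lyap_drift lam (\<rho> k \<omega>) < 0" if "\<not> rtr (\<rho> k \<omega> ** sigma_z) \<ge> 1 - threshold lam"
      using lyap_drift_neg[OF lam state_S1[OF elim(2)], of k] that lam by (simp add: mult_pos_neg)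
    then show ?case unfolding elim(1) vdrift_def by auto
  qed
qed (rule threshold_tendsto_0)

end
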